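(* Every bounded polytope $\mathcal{P} \subset \mathbb{R}^n$ can be equivalently represented in Z-representation; that is, there exist $c \in \mathbb{R}^n$, a generator matrix $G \in \mathbb{R}^{n \times h}$, an integer $p \ge 0$ and a tuple $\mathcal{E} = (e_1,\dots,e_h)$ as in the definition of Z-representation below such that $\mathcal{P} = \langle c, G, \mathcal{E}\rangle_Z$.
   Context: A bounded polytope is a set of the form $\{\sum_{i=1}^q \beta_i v_i \mid \beta_i \ge 0, \sum_{i=1}^q \beta_i = 1\}$ for finitely many points $v_1,\dots,v_q \in \mathbb{R}^n$, $q \ge 1$ (V-representation). Z-representation: given $c \in \mathbb{R}^n$, $G \in \mathbb{R}^{n\times h}$ (columns $G_{(\cdot,i)}$ are called generators, $h \ge 0$), a number of factors $p \ge 0$, and a tuple $\mathcal{E} = (e_1,\dots,e_h)$ where each $e_i \in \{1,\dots,p\}^{m_i}$ is a vector whose entries $e_{i(1)},\dots,e_{i(m_i)}$ are pairwise distinct, the set $\langle c,G,\mathcal{E}\rangle_Z$ is $$\Big\{ c + \sum_{i=1}^h \Big(\prod_{k=1}^{m_i} \alpha_{e_{i(k)}}\Big) G_{(\cdot,i)} \;\Big|\; \alpha_1,\dots,\alpha_p \in [-1,1]\Big\}$$ (an empty product equals $1$; with $h=0$, $G = [\,]$ the empty matrix and $\mathcal{E} = \emptyset$ the empty tuple, the set is $\{c\}$). *)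

theory Defs
  imports "HOL-Analysis.Analysis"
begin

text \<open>
  The library's \<^const>\<open>polytope\<close> includes the empty set, which has no
  V-representation with at least one point.  The second lemma below confirms that the nonempty
  polytopes are exactly the sets with such a V-representation.
\<close>

lemma convex_hull_V_representation:
  fixes v :: "nat \<Rightarrow> 'a::real_vector"
  shows "convex hull (v ` {1..q}) =
    {(\<Sum>i=1..q. \<beta> i *\<^sub>R v i) | \<beta>. (\<forall>i\<in>{1..q}. \<beta> i \<ge> 0) \<and> (\<Sum>i=1..q. \<beta> i) = (1::real)}"
    (is "_ = ?V")
proof
  have gen: "v ` {1..q} \<subseteq> ?V"
  proof clarify
    fix j assume j: "j \<in> {1..q}"
    have "(\<Sum>i=1..q. (if i = j then 1 else 0::real) *\<^sub>R v i) = (\<Sum>i=1..q. if i = j then v i else 0)"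
      by (rule sum.cong) auto
    then have "v j = (\<Sum>i=1..q. (if i = j then 1 else 0::real) *\<^sub>R v i)"
      using j by simp
    moreover have "(\<Sum>i=1..q. if i = j then 1 else 0::real) = 1"
      using j by simp
    ultimately show "\<exists>\<beta>. v j = (\<Sum>i=1..q. \<beta> i *\<^sub>R v i) \<and> (\<forall>i\<in>{1..q}. \<beta> i \<ge> 0) \<and> (\<Sum>i=1..q. \<beta> i) = (1::real)"
      by (intro exI[of _ "\<lambda>i. if i = j then 1 else 0"]) auto
  qed
  have "convex ?V"
  proof (rule convexI, clarify)
    fix s t :: real and \<beta> \<gamma> :: "nat \<Rightarrow> real"
    assume "0 \<le> s" "0 \<le> t" "s + t = 1"
      and "\<forall>i\<in>{1..q}. 0 \<le> \<beta> i" "\<forall>i\<in>{1..q}. 0 \<le> \<gamma> i" "sum \<beta> {1..q} = 1" "sum \<gamma> {1..q} = 1"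
    then show "\<exists>\<delta>. s *\<^sub>R (\<Sum>i=1..q. \<beta> i *\<^sub>R v i) + t *\<^sub>R (\<Sum>i=1..q. \<gamma> i *\<^sub>R v i) = (\<Sum>i=1..q. \<delta> i *\<^sub>R v i)
        \<and> (\<forall>i\<in>{1..q}. \<delta> i \<ge> 0) \<and> sum \<delta> {1..q} = (1::real)"
      by (intro exI[of _ "\<lambda>i. s * \<beta> i + t * \<gamma> i"])
        (auto simp: scaleR_sum_right scaleR_add_left sum.distrib simp flip: sum_distrib_left)
  qed
  then show "convex hull (v ` {1..q}) \<subseteq> ?V"
    using gen by (rule hull_minimal[rotated])
  show "?V \<subseteq> convex hull (v ` {1..q})"
    proof clarify
    fix \<beta> :: "nat \<Rightarrow> real"
    assume "\<forall>i\<in>{1..q}. 0 \<le> \<beta> i" "sum \<beta> {1..q} = 1"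
    then show "(\<Sum>i=1..q. \<beta> i *\<^sub>R v i) \<in> convex hull (v ` {1..q})"
      by (intro convex_sum convex_convex_hull) (auto intro: hull_inc)
  qed
qed

lemma nonempty_polytope_iff_V_representation:
  fixes P :: "(real ^ 'n) set"
  shows "polytope P \<and> P \<noteq> {} \<longleftrightarrow>
    (\<exists>q\<ge>1. \<exists>v :: nat \<Rightarrow> real ^ 'n. P = {(\<Sum>i=1..q. \<beta> i *\<^sub>R v i) | \<beta>. (\<forall>i\<in>{1..q}. \<beta> i \<ge> 0) \<and> (\<Sum>i=1..q. \<beta> i) = (1::real)})"
    (is "_ \<longleftrightarrow> ?R")
proof -
  have "?R \<longleftrightarrow> (\<exists>q\<ge>1. \<exists>v :: nat \<Rightarrow> real ^ 'n. P = convex hull (v ` {1..q}))"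
    by (simp only: convex_hull_V_representation)
  also have "\<dots> \<longleftrightarrow> polytope P \<and> P \<noteq> {}"
  proof
    assume "\<exists>q\<ge>1. \<exists>v :: nat \<Rightarrow> real ^ 'n. P = convex hull (v ` {1..q})"
    then show "polytope P \<and> P \<noteq> {}"
      by (auto simp: polytope_def)
  next
    assume P: "polytope P \<and> P \<noteq> {}"
    then obtain S where S: "finite S" "P = convex hull S"
      by (auto simp: polytope_def)
    then obtain v where "bij_betw v {1..card S} S"
      using ex_bij_betw_nat_finite_1 by blast
    moreover have "card S \<ge> 1"
      using P S by (metis card_gt_0_iff convex_hull_empty less_eq_Suc_le One_nat_def)
    ultimately show "\<exists>q\<ge>1. \<exists>v :: nat \<Rightarrow> real ^ 'n. P = convex hull (v ` {1..q})"
      using S by (metis bij_betw_imp_surj_on)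
  qed
  finally show ?thesis by blast
qed

text \<open>
  The number \<open>h\<close> of generators is not fixed in advance, so the generator matrix is given as
  the list of its \<open>h\<close> columns, and the tuple \<open>(e\<^sub>1, \<dots>, e\<^sub>h)\<close> as a list of lists.  Positions in
  these lists are counted from 0, whereas the entries of the \<open>e\<^sub>i\<close>, i.e. the indices of the
  factors, range over \<open>{1..p}\<close>.  The values of \<open>\<alpha>\<close> outside \<open>{1..p}\<close> are irrelevant for index
  tuples satisfying \<open>Z_index_tuple\<close>.
\<close>

definition Z_index_tuple :: "nat \<Rightarrow> nat \<Rightarrow> nat list list \<Rightarrow> bool" where
  "Z_index_tuple h p E \<longleftrightarrow> length E = h \<and> (\<forall>e\<in>set E. distinct e \<and> set e \<subseteq> {1..p})"

definition Z_set :: "nat \<Rightarrow> real ^ 'n \<Rightarrow> (real ^ 'n) list \<Rightarrow> nat list list \<Rightarrow> (real ^ 'n) set" where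
  "Z_set p c G E =
     {c + (\<Sum>i<length G. (\<Prod>k<length (E ! i). \<alpha> (E ! i ! k)) *\<^sub>R (G ! i)) | \<alpha> :: nat \<Rightarrow> real.
        \<forall>j\<in>{1..p}. \<alpha> j \<in> {-1..1}}"

end

theory Submission
  imports Defs
begin

text \<open>
  Induction on the vertices.  Every point of the convex hull of \<open>insert v S\<close> is \<open>v + t (x - v)\<close>
  with \<open>x\<close> in the convex hull of \<open>S\<close> and \<open>t \<in> [0,1]\<close>.  Writing \<open>t = (1 + \<beta>) / 2\<close> with a new
  factor \<open>\<beta> \<in> [-1,1]\<close> and expanding the product with \<open>x = c + \<Sum>\<^sub>i m\<^sub>i g\<^sub>i\<close> gives
  \<open>(v + c)/2 + \<beta> (c - v)/2 + \<Sum>\<^sub>i m\<^sub>i g\<^sub>i/2 + \<Sum>\<^sub>i \<beta> m\<^sub>i g\<^sub>i/2\<close>, whose monomials are again squarefree.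
\<close>

text \<open>Summing over zipped lists instead of positions lets the appended and mapped lists of the
  induction step be split by simplification.\<close>

definition Z_eval :: "(nat \<Rightarrow> real) \<Rightarrow> real ^ 'n \<Rightarrow> (real ^ 'n) list \<Rightarrow> nat list list \<Rightarrow> real ^ 'n" where
  "Z_eval \<alpha> c G E = c + (\<Sum>(g, e)\<leftarrow>zip G E. prod_list (map \<alpha> e) *\<^sub>R g)"

lemma Z_set_eq_image_Z_eval:
  assumes "length E = length G"
  shows "Z_set p c G E = (\<lambda>\<alpha>. Z_eval \<alpha> c G E) ` {\<alpha>. \<forall>j\<in>{1..p}. \<alpha> j \<in> {-1..1}}"
proof -
  have "c + (\<Sum>i<length G. (\<Prod>k<length (E ! i). \<alpha> (E ! i ! k)) *\<^sub>R (G ! i)) = Z_eval \<alpha> c G E" for \<alpha>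
    using assms
    by (simp add: Z_eval_def sum_list_sum_nth prod.list_conv_set_nth atLeast0LessThan)
  then show ?thesis
    unfolding Z_set_def by auto
qed

text \<open>Allows a fresh factor to be set at will without moving the point.\<close>

lemma Z_eval_cong:
  assumes "\<And>e j. e \<in> set E \<Longrightarrow> j \<in> set e \<Longrightarrow> \<alpha> j = \<beta> j"
  shows "Z_eval \<alpha> c G E = Z_eval \<beta> c G E"
proof -
  have "map \<alpha> e = map \<beta> e" if "(g, e) \<in> set (zip G E)" for g e
    using that assms by (auto dest: set_zip_rightD)
  then have "map (\<lambda>(g, e). prod_list (map \<alpha> e) *\<^sub>R g) (zip G E)
           = map (\<lambda>(g, e). prod_list (map \<beta> e) *\<^sub>R g) (zip G E)"
    by (intro map_cong refl) (metis case_prod_conv surj_pair)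
  then show ?thesis
    unfolding Z_eval_def by (rule arg_cong)
qed

text \<open>Serves both copies of the generators: \<open>f = id\<close> keeps the monomials, while
  \<open>f = (#) q\<close> multiplies each by the new factor.\<close>

lemma sum_list_monomials_scaled:
  fixes G :: "'a::real_vector list" and f :: "nat list \<Rightarrow> nat list"
  assumes "\<And>e. prod_list (map \<alpha> (f e)) = s * prod_list (map \<alpha> e)"
  shows "(\<Sum>(g, e)\<leftarrow>zip (map ((*\<^sub>R) r) G) (map f E). prod_list (map \<alpha> e) *\<^sub>R g)
       = (r * s) *\<^sub>R (\<Sum>(g, e)\<leftarrow>zip G E. prod_list (map \<alpha> e) *\<^sub>R g)"
  by (induction G E rule: list_induct2') (auto simp: assms scaleR_add_right mult_ac)

text \<open>The two weights sum to 1 and are nonnegative for \<open>\<alpha> q\<close> in [-1,1], so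
  the new factor slides the point along the segment from \<open>v\<close> to the old point.\<close>

lemma Z_eval_cone:
  fixes v c :: "real ^ 'n"
  assumes "length E = length G"
  shows "Z_eval \<alpha> ((1/2) *\<^sub>R (v + c))
           ((1/2) *\<^sub>R (c - v) # map ((*\<^sub>R) (1/2)) G @ map ((*\<^sub>R) (1/2)) G)
           ([q] # E @ map ((#) q) E)
         = ((1 - \<alpha> q) / 2) *\<^sub>R v + ((1 + \<alpha> q) / 2) *\<^sub>R Z_eval \<alpha> c G E"
proof -
  define T where "T = (\<Sum>(g, e)\<leftarrow>zip G E. prod_list (map \<alpha> e) *\<^sub>R g)"
  have "Z_eval \<alpha> ((1/2) *\<^sub>R (v + c))
           ((1/2) *\<^sub>R (c - v) # map ((*\<^sub>R) (1/2)) G @ map ((*\<^sub>R) (1/2)) G)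
           ([q] # E @ map ((#) q) E)
        = (1/2) *\<^sub>R (v + c) + (\<alpha> q *\<^sub>R (1/2) *\<^sub>R (c - v) + ((1/2) *\<^sub>R T + (1/2 * \<alpha> q) *\<^sub>R T))"
    using assms sum_list_monomials_scaled[of \<alpha> id 1 "1/2" G E]
      sum_list_monomials_scaled[of \<alpha> "(#) q" "\<alpha> q" "1/2" G E]
    by (simp add: Z_eval_def T_def)
  also have "\<dots> = ((1 - \<alpha> q) / 2) *\<^sub>R v + ((1 + \<alpha> q) / 2) *\<^sub>R (c + T)"
    by (simp add: vec_eq_iff field_simps)
  finally show ?thesis
    by (simp add: Z_eval_def T_def)
qed

text \<open>The factors 1 to \<open>p\<close> choose a point of the hull of \<open>S\<close>;
  independently, \<open>Suc p\<close> chooses the position on the segment joining it to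
  \<open>v\<close>.\<close>

lemma convex_hull_insert_Z_set:
  fixes v c :: "real ^ 'n"
  assumes "S \<noteq> {}" and hull: "convex hull S = Z_set p c G E" and E: "Z_index_tuple (length G) p E"
  shows "convex hull (insert v S)
       = Z_set (Suc p) ((1/2) *\<^sub>R (v + c))
           ((1/2) *\<^sub>R (c - v) # map ((*\<^sub>R) (1/2)) G @ map ((*\<^sub>R) (1/2)) G)
           ([Suc p] # E @ map ((#) (Suc p)) E)"
    (is "_ = Z_set _ ?c ?G ?E")
proof -
  have len: "length E = length G" and range: "\<And>e j. e \<in> set E \<Longrightarrow> j \<in> set e \<Longrightarrow> j \<in> {1..p}"
    using E unfolding Z_index_tuple_def by blast+
  have "convex hull (insert v S) = (\<lambda>\<alpha>. Z_eval \<alpha> ?c ?G ?E) ` {\<alpha>. \<forall>j\<in>{1..Suc p}. \<alpha> j \<in> {-1..1}}"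
  proof (intro equalityI subsetI)
    fix x
    assume "x \<in> convex hull (insert v S)"
    then obtain s t y where st: "s \<ge> 0" "t \<ge> 0" "s + t = 1" and y: "y \<in> convex hull S"
      and x: "x = s *\<^sub>R v + t *\<^sub>R y"
      using \<open>S \<noteq> {}\<close> by (auto simp: convex_hull_insert)
    from y obtain \<alpha> where \<alpha>: "\<forall>j\<in>{1..p}. \<alpha> j \<in> {-1..1}" "y = Z_eval \<alpha> c G E"
      by (auto simp: hull Z_set_eq_image_Z_eval[OF len])
    \<comment> \<open>The value \<open>2 * t - 1\<close> solves
      \<open>(1 + \<beta> (Suc p)) / 2 = t\<close> and lies in [-1,1] because \<open>t\<close> lies
      in [0,1].\<close>
    define \<beta> where "\<beta> = \<alpha>(Suc p := 2 * t - 1)"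
    have "Z_eval \<beta> c G E = Z_eval \<alpha> c G E"
      \<comment> \<open>The entries of \<open>E\<close> are at most \<open>p\<close>, so the update
        at \<open>Suc p\<close> is invisible.\<close>
      by (rule Z_eval_cong) (use range in \<open>force simp: \<beta>_def\<close>)
    moreover have "(1 - \<beta> (Suc p)) / 2 = s" "(1 + \<beta> (Suc p)) / 2 = t"
      using st by (auto simp: \<beta>_def field_simps)
    ultimately have "x = Z_eval \<beta> ?c ?G ?E"
      by (simp only: Z_eval_cone[OF len] x \<alpha>)
    moreover have "\<forall>j\<in>{1..Suc p}. \<beta> j \<in> {-1..1}"
      using \<alpha> st by (auto simp: \<beta>_def)
    ultimately show "x \<in> (\<lambda>\<alpha>. Z_eval \<alpha> ?c ?G ?E) ` {\<alpha>. \<forall>j\<in>{1..Suc p}. \<alpha> j \<in> {-1..1}}"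
      by blast
  next
    fix x
    assume "x \<in> (\<lambda>\<alpha>. Z_eval \<alpha> ?c ?G ?E) ` {\<alpha>. \<forall>j\<in>{1..Suc p}. \<alpha> j \<in> {-1..1}}"
    then obtain \<alpha> where \<alpha>: "\<forall>j\<in>{1..Suc p}. \<alpha> j \<in> {-1..1}" and x: "x = Z_eval \<alpha> ?c ?G ?E"
      by blast
    have "Z_eval \<alpha> c G E \<in> convex hull S"
      using \<alpha> by (auto simp: hull Z_set_eq_image_Z_eval[OF len])
    then have y: "Z_eval \<alpha> c G E \<in> convex hull (insert v S)"
      using hull_mono[of S "insert v S" convex] by blast
    have v: "v \<in> convex hull (insert v S)"
      by (simp add: hull_inc)
    have "\<alpha> (Suc p) \<in> {-1..1}"
      using \<alpha> by simp
    then show "x \<in> convex hull (insert v S)"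
      unfolding x Z_eval_cone[OF len]
      by (intro convexD[OF convex_convex_hull v y]) (auto simp: field_simps)
  qed
  then show ?thesis
    using len by (simp add: Z_set_eq_image_Z_eval)
qed

lemma convex_hull_finite_eq_Z_set:
  fixes S :: "(real ^ 'n) set"
  assumes "finite S" and "S \<noteq> {}"
  shows "\<exists>c G p E. Z_index_tuple (length G) p E \<and> convex hull S = Z_set p c G E"
  using assms
proof (induction S rule: finite_ne_induct)
  case (singleton v)
  \<comment> \<open>A single point needs neither factors nor generators.\<close>
  have "Z_index_tuple (length []) 0 []" "convex hull {v} = Z_set 0 v [] []"
    by (auto simp: Z_index_tuple_def Z_set_def)
  then show ?case
    by blast
next
  case (insert v S)
  then obtain c G p E where E: "Z_index_tuple (length G) p E" and S: "convex hull S = Z_set p c G E"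
    by blast
  let ?G = "(1/2) *\<^sub>R (c - v) # map ((*\<^sub>R) (1/2)) G @ map ((*\<^sub>R) (1/2)) G"
  \<comment> \<open>Since \<open>Suc p\<close> exceeds all entries of \<open>E\<close>, prepending
    it keeps the index lists distinct.\<close>
  have "Z_index_tuple (length ?G) (Suc p) ([Suc p] # E @ map ((#) (Suc p)) E)"
    using E by (fastforce simp: Z_index_tuple_def)
  then show ?case
    using convex_hull_insert_Z_set[OF \<open>S \<noteq> {}\<close> S E, of v] by blast
qed

theorem theorem1:
  fixes P :: "(real ^ 'n) set"
  assumes "polytope P" and "P \<noteq> {}"
  shows "\<exists>(c :: real ^ 'n) (h :: nat) (G :: (real ^ 'n) list) (p :: nat) (E :: nat list list).
           length G = h \<and> Z_index_tuple h p E \<and> P = Z_set p c G E"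
proof -
  obtain S where "finite S" "P = convex hull S"
    using \<open>polytope P\<close> by (auto simp: polytope_def)
  then show ?thesis
    using convex_hull_finite_eq_Z_set[of S] \<open>P \<noteq> {}\<close> by auto
qed

end
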